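(* Let $G\neq\{1\}$ be a group that decomposes as an extension $$1\longrightarrow K\longrightarrow G\overset{\pi}{\longrightarrow}Q\longrightarrow 1,$$ with coupling $\Theta:Q\to\mathrm{Out}(K)$, and let $\Phi:FC(Q)\to\mathrm{Out}(K)$ be the restriction of $\Theta$ to $FC(Q)$. Suppose that $FC(Q)$ is finitely generated or, more generally, that $C_Q(FC(Q))$ has finite index in $Q$. Then $G$ is icc if and only if both of the following conditions hold: (i) $FC_G(K)=\{1\}$; (ii$'$) the homomorphism $\Xi:\ker\Phi\to H^1(C_Q(FC(Q)),Z)$ is injective.
   Context: A group is icc if it is infinite and all of its conjugacy classes except $\{1\}$ are infinite. Write ${}^{y}x=yxy^{-1}$. $FC_G(K)=\{u\in K:\ \text{the } G\text{-conjugacy class of } u\text{ is finite}\}$; $FC(Q)$ is the subgroup of elements of $Q$ with finite conjugacy class; $C_Q(FC(Q))$ is the centralizer of $FC(Q)$ in $Q$; $Z=Z(K)$ is the center of $K$. The coupling $\Theta:Q\to\mathrm{Out}(K)$ sends $q$ to the class of $x\mapsto gxg^{-1}$ for any $g\in\pi^{-1}(q)$. The homomorphism $\Xi$: choose a set-theoretic section $q\mapsto\overline q$ of $\pi$. $Q$ acts on $Z$ by $u\cdot z={}^{\overline u}z$. For $q\in\ker\Phi$ choose $k\in K$ with $\overline q\,x\,\overline q^{-1}=kxk^{-1}$ for all $x\in K$; for $u\in C_Q(FC(Q))$ let $\delta_q(u)\in K$ be defined by $\overline u\,\overline q\,\overline u^{-1}=\overline q\,\delta_q(u)$ and put $d_q(u)=\delta_q(u)^{-1}k^{-1}({}^{\overline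 u}k)$. Then $d_q:C_Q(FC(Q))\to Z$ is a 1-cocycle, and $\Xi(q)\in H^1(C_Q(FC(Q)),Z)$ is its class, which does not depend on the choices; $\Xi$ is a group homomorphism. Here, for a subgroup $P\leq Q$, $H^1(P,Z)$ is the quotient of the abelian group (under pointwise multiplication) of maps $f:P\to Z$ with $f(uv)=f(u)({}^{\overline u}f(v))$ by the subgroup of maps $u\mapsto z^{-1}({}^{\overline u}z)$, $z\in Z$. *)

theory Defs
  imports "HOL-Algebra.Algebra"
begin

definition conjugation :: "('a, 'm) monoid_scheme \<Rightarrow> 'a \<Rightarrow> 'a \<Rightarrow> 'a"
  where "conjugation G g x = g \<otimes>\<^bsub>G\<^esub> x \<otimes>\<^bsub>G\<^esub> inv\<^bsub>G\<^esub> g"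

definition conjugacy_class :: "('a, 'm) monoid_scheme \<Rightarrow> 'a \<Rightarrow> 'a set"
  where "conjugacy_class G x = orbit G (conjugation G) x"

definition icc :: "('a, 'm) monoid_scheme \<Rightarrow> bool"
  where "icc G \<longleftrightarrow> infinite (carrier G) \<and>
    (\<forall>x\<in>carrier G. x \<noteq> \<one>\<^bsub>G\<^esub> \<longrightarrow> infinite (conjugacy_class G x))"

definition FC_in :: "('a, 'm) monoid_scheme \<Rightarrow> 'a set \<Rightarrow> 'a set"
  where "FC_in G K = {u \<in> K. finite (conjugacy_class G u)}"

definition FC :: "('a, 'm) monoid_scheme \<Rightarrow> 'a set"
  where "FC G = FC_in G (carrier G)"

definition centralizer :: "('a, 'm) monoid_scheme \<Rightarrow> 'a set \<Rightarrow> 'a set"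
  where "centralizer G S = {g \<in> carrier G. \<forall>x\<in>S. g \<otimes>\<^bsub>G\<^esub> x = x \<otimes>\<^bsub>G\<^esub> g}"

definition center :: "('a, 'm) monoid_scheme \<Rightarrow> 'a set"
  where "center G = centralizer G (carrier G)"

definition fin_gen_subgroup :: "('a, 'm) monoid_scheme \<Rightarrow> 'a set \<Rightarrow> bool"
  where "fin_gen_subgroup G H \<longleftrightarrow> (\<exists>S. finite S \<and> S \<subseteq> H \<and> generate G S = H)"

definition finite_index :: "('a, 'm) monoid_scheme \<Rightarrow> 'a set \<Rightarrow> bool"
  where "finite_index G H \<longleftrightarrow> finite (rcosets\<^bsub>G\<^esub> H)"

definition Inn :: "('a, 'm) monoid_scheme \<Rightarrow> ('a \<Rightarrow> 'a) set"
  where "Inn G = (\<lambda>g. \<lambda>x\<in>carrier G. conjugation G g x) ` carrier G"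

definition Out :: "('a, 'm) monoid_scheme \<Rightarrow> ('a \<Rightarrow> 'a) set monoid"
  where "Out G = AutoGroup G Mod Inn G"

text \<open>Below, \<open>K\<close> is a subgroup of \<open>G\<close>, the kernel of the surjection \<open>\<pi>\<close> from \<open>G\<close> onto \<open>Q\<close>.
  The description picks out a single class because two preimages of \<open>q\<close> differ by an element
  of \<open>K\<close>; see \<open>coupling_eq\<close>.\<close>

definition coupling ::
  "('a, 'm) monoid_scheme \<Rightarrow> 'a set \<Rightarrow> ('a \<Rightarrow> 'b) \<Rightarrow> 'b \<Rightarrow> ('a \<Rightarrow> 'a) set"
  where "coupling G K \<pi> q =
    (THE c. \<exists>g\<in>carrier G. \<pi> g = q \<and>
       c = Inn (G\<lparr>carrier := K\<rparr>) #>\<^bsub>AutoGroup (G\<lparr>carrier := K\<rparr>)\<^esub> (\<lambda>x\<in>K. conjugation G g x))"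

definition FC_coupling ::
  "('a, 'm) monoid_scheme \<Rightarrow> 'a set \<Rightarrow> ('b, 'n) monoid_scheme \<Rightarrow> ('a \<Rightarrow> 'b) \<Rightarrow> 'b \<Rightarrow> ('a \<Rightarrow> 'a) set"
  where "FC_coupling G K Q \<pi> = restrict (coupling G K \<pi>) (FC Q)"

definition ker_FC_coupling ::
  "('a, 'm) monoid_scheme \<Rightarrow> 'a set \<Rightarrow> ('b, 'n) monoid_scheme \<Rightarrow> ('a \<Rightarrow> 'b) \<Rightarrow> 'b set"
  where "ker_FC_coupling G K Q \<pi> =
    kernel (Q\<lparr>carrier := FC Q\<rparr>) (Out (G\<lparr>carrier := K\<rparr>)) (FC_coupling G K Q \<pi>)"

definition set_section ::
  "('a, 'm) monoid_scheme \<Rightarrow> ('b, 'n) monoid_scheme \<Rightarrow> ('a \<Rightarrow> 'b) \<Rightarrow> ('b \<Rightarrow> 'a) \<Rightarrow> bool"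
  where "set_section G Q \<pi> s \<longleftrightarrow> (\<forall>q\<in>carrier Q. s q \<in> carrier G \<and> \<pi> (s q) = q)"

text \<open>Cohomology in degree one of a subgroup \<open>P\<close> of \<open>Q\<close> with coefficients in \<open>Z\<close>, written
  multiplicatively inside \<open>G\<close>, on which \<open>u\<close> acts as conjugation by the lift \<open>s u\<close>. Cocycles are
  extensional, so that they are genuinely functions on \<open>P\<close>.\<close>

definition cocycle_group ::
  "('a, 'm) monoid_scheme \<Rightarrow> 'a set \<Rightarrow> ('b, 'n) monoid_scheme \<Rightarrow> ('b \<Rightarrow> 'a) \<Rightarrow> 'b set \<Rightarrow> ('b \<Rightarrow> 'a) monoid"
  where "cocycle_group G Z Q s P =
    \<lparr>carrier = {f \<in> P \<rightarrow>\<^sub>E Z. \<forall>u\<in>P. \<forall>v\<in>P. f (u \<otimes>\<^bsub>Q\<^esub> v) = f u \<otimes>\<^bsub>G\<^esub> conjugation G (s u) (f v)},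
     monoid.mult = (\<lambda>f g. \<lambda>u\<in>P. f u \<otimes>\<^bsub>G\<^esub> g u),
     one = (\<lambda>u\<in>P. \<one>\<^bsub>G\<^esub>)\<rparr>"

definition coboundaries ::
  "('a, 'm) monoid_scheme \<Rightarrow> 'a set \<Rightarrow> ('b \<Rightarrow> 'a) \<Rightarrow> 'b set \<Rightarrow> ('b \<Rightarrow> 'a) set"
  where "coboundaries G Z s P = (\<lambda>z. \<lambda>u\<in>P. inv\<^bsub>G\<^esub> z \<otimes>\<^bsub>G\<^esub> conjugation G (s u) z) ` Z"

definition H1 ::
  "('a, 'm) monoid_scheme \<Rightarrow> 'a set \<Rightarrow> ('b, 'n) monoid_scheme \<Rightarrow> ('b \<Rightarrow> 'a) \<Rightarrow> 'b set \<Rightarrow> ('b \<Rightarrow> 'a) set monoid"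
  where "H1 G Z Q s P = cocycle_group G Z Q s P Mod coboundaries G Z s P"

definition kernel_choice ::
  "('a, 'm) monoid_scheme \<Rightarrow> 'a set \<Rightarrow> ('b, 'n) monoid_scheme \<Rightarrow> ('a \<Rightarrow> 'b) \<Rightarrow> ('b \<Rightarrow> 'a) \<Rightarrow> ('b \<Rightarrow> 'a) \<Rightarrow> bool"
  where "kernel_choice G K Q \<pi> s k \<longleftrightarrow>
    (\<forall>q\<in>ker_FC_coupling G K Q \<pi>. k q \<in> K \<and>
       (\<forall>x\<in>K. conjugation G (s q) x = conjugation G (k q) x))"

text \<open>The first factor is the inverse of the element \<open>\<delta>\<close> with
  \<open>conjugation G (s u) (s q) = s q \<otimes> \<delta>\<close>.\<close>

definition Xi_cocycle ::
  "('a, 'm) monoid_scheme \<Rightarrow> ('b, 'n) monoid_scheme \<Rightarrow> ('b \<Rightarrow> 'a) \<Rightarrow> ('b \<Rightarrow> 'a) \<Rightarrow> 'b \<Rightarrow> 'b \<Rightarrow> 'a"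
  where "Xi_cocycle G Q s k q =
    (\<lambda>u\<in>centralizer Q (FC Q).
       inv\<^bsub>G\<^esub> (inv\<^bsub>G\<^esub> (s q) \<otimes>\<^bsub>G\<^esub> conjugation G (s u) (s q)) \<otimes>\<^bsub>G\<^esub> inv\<^bsub>G\<^esub> (k q) \<otimes>\<^bsub>G\<^esub> conjugation G (s u) (k q))"

definition Xi ::
  "('a, 'm) monoid_scheme \<Rightarrow> 'a set \<Rightarrow> ('b, 'n) monoid_scheme \<Rightarrow> ('b \<Rightarrow> 'a) \<Rightarrow> ('b \<Rightarrow> 'a) \<Rightarrow> 'b \<Rightarrow> ('b \<Rightarrow> 'a) set"
  where "Xi G K Q s k q =
    (let Z = center (G\<lparr>carrier := K\<rparr>); P = centralizer Q (FC Q)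
     in coboundaries G Z s P #>\<^bsub>cocycle_group G Z Q s P\<^esub> Xi_cocycle G Q s k q)"

text \<open>Well-definedness of the coupling, and a description of the kernel of its restriction from
  which the existence of a \<open>kernel_choice\<close> is immediate.\<close>

lemma (in group) conjugation_closed: "g \<in> carrier G \<Longrightarrow> x \<in> carrier G \<Longrightarrow> conjugation G g x \<in> carrier G"
  by (simp add: conjugation_def)

lemma (in group) conjugation_comp:
  assumes "g \<in> carrier G" "h \<in> carrier G" "x \<in> carrier G"
  shows "conjugation G (g \<otimes> h) x = conjugation G g (conjugation G h x)"
  using assms by (simp add: conjugation_def inv_mult_group m_assoc)

lemma (in group) conjugation_mult:
  assumes "g \<in> carrier G" "y \<in> carrier G" "x \<in> carrier G"
  shows "conjugation G g (x \<otimes> y) = conjugation G g x \<otimes> conjugation G g y"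
proof -
  have "inv g \<otimes> (g \<otimes> w) = w" if "w \<in> carrier G" for w
    using that assms by (simp add: m_assoc[symmetric])
  then show ?thesis using assms by (simp add: conjugation_def m_assoc)
qed

lemma (in group) conjugation_one: "x \<in> carrier G \<Longrightarrow> conjugation G \<one> x = x"
  by (simp add: conjugation_def)

lemma (in group) conjugation_eq_iff:
  assumes "g \<in> carrier G" "x \<in> carrier G" "y \<in> carrier G"
  shows "conjugation G g x = conjugation G g y \<longleftrightarrow> x = y"
  using assms by (simp add: conjugation_def)

lemma (in group) commute_inv:
  assumes "x \<in> carrier G" "y \<in> carrier G" "x \<otimes> y = y \<otimes> x"
  shows "inv x \<otimes> y = y \<otimes> inv x"
proof -
  have "inv x \<otimes> y = inv x \<otimes> (y \<otimes> x) \<otimes> inv x"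
    using assms(1,2) by (simp add: m_assoc)
  also have "\<dots> = inv x \<otimes> (x \<otimes> y) \<otimes> inv x"
    by (simp only: assms(3))
  also have "\<dots> = y \<otimes> inv x"
    using assms(1,2) by (simp add: m_assoc[symmetric])
  finally show ?thesis .
qed

lemma (in group) commute_mult:
  assumes "x \<in> carrier G" "y \<in> carrier G" "z \<in> carrier G"
    and "x \<otimes> z = z \<otimes> x" "y \<otimes> z = z \<otimes> y"
  shows "x \<otimes> y \<otimes> z = z \<otimes> (x \<otimes> y)"
proof -
  have "x \<otimes> y \<otimes> z = x \<otimes> (z \<otimes> y)"
    using assms(1-3) by (simp add: m_assoc assms(5))
  also have "\<dots> = z \<otimes> x \<otimes> y"
    using assms(1-3) by (simp add: m_assoc[symmetric] assms(4))
  finally show ?thesis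
    using assms(1-3) by (simp add: m_assoc)
qed

lemma (in group) subgroup_centralizer:
  assumes "S \<subseteq> carrier G"
  shows "subgroup (centralizer G S) G"
proof (rule subgroupI)
  show "centralizer G S \<subseteq> carrier G"
    by (auto simp: centralizer_def)
  have "\<one> \<in> centralizer G S"
    using assms by (auto simp: centralizer_def)
  then show "centralizer G S \<noteq> {}"
    by blast
next
  fix x assume x: "x \<in> centralizer G S"
  have "inv x \<otimes> y = y \<otimes> inv x" if "y \<in> S" for y
    by (rule commute_inv) (use x that assms in \<open>auto simp: centralizer_def\<close>)
  then show "inv x \<in> centralizer G S"
    using x by (simp add: centralizer_def)
next
  fix x y assume *: "x \<in> centralizer G S" "y \<in> centralizer G S"
  have "x \<otimes> y \<otimes> z = z \<otimes> (x \<otimes> y)" if "z \<in> S" for z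
    by (rule commute_mult) (use * that assms in \<open>auto simp: centralizer_def\<close>)
  then show "x \<otimes> y \<in> centralizer G S"
    using * by (simp add: centralizer_def)
qed

lemma (in group) conjugation_eq_self_iff:
  assumes "g \<in> carrier G" "x \<in> carrier G"
  shows "conjugation G g x = x \<longleftrightarrow> g \<otimes> x = x \<otimes> g"
  using assms inv_solve_right'[of x "g \<otimes> x" g] by (auto simp: conjugation_def)

lemma (in group_hom) surj_kernel_fibre:
  assumes "g \<in> carrier G" "g' \<in> carrier G" "h g = h g'"
  shows "\<exists>x\<in>kernel G H h. g = x \<otimes> g'"
  using assms
  by (intro bexI[of _ "g \<otimes> inv g'"]) (auto simp: kernel_def G.m_assoc)

lemma (in normal) image_mult_right: "z \<in> H \<Longrightarrow> (\<lambda>y. y \<otimes> z) ` H = H"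
  using rcos_const[OF is_group, of z] unfolding r_coset_def UNION_singleton_eq_range .

lemma (in normal) conjugation_in: "g \<in> carrier G \<Longrightarrow> x \<in> H \<Longrightarrow> conjugation G g x \<in> H"
  by (simp add: conjugation_def inv_op_closed2)

lemma (in normal) conjugation_Bij:
  assumes g: "g \<in> carrier G"
  shows "(\<lambda>x\<in>H. conjugation G g x) \<in> Bij H"
proof -
  have "bij_betw (conjugation G g) H H"
  proof (rule bij_betw_byWitness[where f' = "conjugation G (inv g)"])
    show "\<forall>a\<in>H. conjugation G (inv g) (conjugation G g a) = a"
      using g by (auto simp: conjugation_comp[symmetric] conjugation_one)
    show "\<forall>a\<in>H. conjugation G g (conjugation G (inv g) a) = a"
      using g by (auto simp: conjugation_comp[symmetric] conjugation_one)
  qed (use g conjugation_in in auto)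
  then show ?thesis by (auto simp: Bij_def)
qed

lemma (in normal) Inn_subgroup:
  "Inn (G\<lparr>carrier := H\<rparr>) = (\<lambda>y. \<lambda>x\<in>H. conjugation G y x) ` H"
proof -
  have "inv\<^bsub>G\<lparr>carrier := H\<rparr>\<^esub> y = inv y" if "y \<in> H" for y
    using that m_inv_consistent subgroup_axioms by simp
  then show ?thesis
    unfolding Inn_def by (intro image_cong) (auto simp: conjugation_def restrict_def)
qed

lemma (in normal) Inn_coset:
  assumes g: "g \<in> carrier G"
  shows "Inn (G\<lparr>carrier := H\<rparr>) #>\<^bsub>AutoGroup (G\<lparr>carrier := H\<rparr>)\<^esub> (\<lambda>x\<in>H. conjugation G g x)
    = (\<lambda>y. \<lambda>x\<in>H. conjugation G (y \<otimes> g) x) ` H"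
proof -
  have "(\<lambda>x\<in>H. conjugation G y x) \<otimes>\<^bsub>AutoGroup (G\<lparr>carrier := H\<rparr>)\<^esub> (\<lambda>x\<in>H. conjugation G g x)
      = (\<lambda>x\<in>H. conjugation G (y \<otimes> g) x)" if "y \<in> H" for y
    using that g conjugation_Bij[of y] conjugation_Bij[OF g] conjugation_in[OF g]
    by (auto simp: AutoGroup_def BijGroup_def compose_def conjugation_comp fun_eq_iff)
  then show ?thesis by (auto simp: r_coset_def Inn_subgroup)
qed

lemma coupling_eq:
  assumes h: "group_hom G Q \<pi>" and K: "K = kernel G Q \<pi>" and g: "g \<in> carrier G"
  shows "coupling G K \<pi> (\<pi> g) =
    Inn (G\<lparr>carrier := K\<rparr>) #>\<^bsub>AutoGroup (G\<lparr>carrier := K\<rparr>)\<^esub> (\<lambda>x\<in>K. conjugation G g x)"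
proof -
  interpret group_hom G Q \<pi> by fact
  interpret normal K G unfolding K by (rule normal_kernel)
  have eq: "(\<lambda>y. \<lambda>x\<in>K. conjugation G (y \<otimes>\<^bsub>G\<^esub> g') x) ` K =
        (\<lambda>y. \<lambda>x\<in>K. conjugation G (y \<otimes>\<^bsub>G\<^esub> g) x) ` K"
    if g': "g' \<in> carrier G" "\<pi> g' = \<pi> g" for g'
  proof -
    obtain z where z: "z \<in> K" "g' = z \<otimes>\<^bsub>G\<^esub> g"
      using surj_kernel_fibre[of g' g, folded K] g' g by auto
    have "(\<lambda>y. y \<otimes>\<^bsub>G\<^esub> z) ` K = K"
      by (rule image_mult_right[OF z(1)])
    then have "(\<lambda>y. \<lambda>x\<in>K. conjugation G (y \<otimes>\<^bsub>G\<^esub> g) x) ` K =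
       (\<lambda>y. \<lambda>x\<in>K. conjugation G (y \<otimes>\<^bsub>G\<^esub> g) x) ` (\<lambda>y. y \<otimes>\<^bsub>G\<^esub> z) ` K" by simp
    also have "\<dots> = (\<lambda>y. \<lambda>x\<in>K. conjugation G (y \<otimes>\<^bsub>G\<^esub> g') x) ` K"
      using z g by (auto simp: image_image G.m_assoc intro!: image_cong)
    finally show ?thesis by simp
  qed
  show ?thesis
    unfolding coupling_def
  proof (rule the_equality)
    show "\<exists>g'\<in>carrier G. \<pi> g' = \<pi> g \<and>
      Inn (G\<lparr>carrier := K\<rparr>) #>\<^bsub>AutoGroup (G\<lparr>carrier := K\<rparr>)\<^esub> (\<lambda>x\<in>K. conjugation G g x) =
      Inn (G\<lparr>carrier := K\<rparr>) #>\<^bsub>AutoGroup (G\<lparr>carrier := K\<rparr>)\<^esub> (\<lambda>x\<in>K. conjugation G g' x)"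
      using g by blast
  next
    fix c
    assume "\<exists>g'\<in>carrier G. \<pi> g' = \<pi> g \<and>
      c = Inn (G\<lparr>carrier := K\<rparr>) #>\<^bsub>AutoGroup (G\<lparr>carrier := K\<rparr>)\<^esub> (\<lambda>x\<in>K. conjugation G g' x)"
    then obtain g' where g': "g' \<in> carrier G" "\<pi> g' = \<pi> g"
      "c = Inn (G\<lparr>carrier := K\<rparr>) #>\<^bsub>AutoGroup (G\<lparr>carrier := K\<rparr>)\<^esub> (\<lambda>x\<in>K. conjugation G g' x)"
      by blast
    show "c = Inn (G\<lparr>carrier := K\<rparr>) #>\<^bsub>AutoGroup (G\<lparr>carrier := K\<rparr>)\<^esub> (\<lambda>x\<in>K. conjugation G g x)"
      unfolding g'(3) Inn_coset[OF g'(1)] Inn_coset[OF g] by (rule eq[OF g'(1,2)])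
  qed
qed

lemma ker_FC_coupling_iff:
  assumes h: "group_hom G Q \<pi>" and K: "K = kernel G Q \<pi>" and g: "g \<in> carrier G" "\<pi> g \<in> FC Q"
  shows "\<pi> g \<in> ker_FC_coupling G K Q \<pi> \<longleftrightarrow>
    (\<exists>k\<in>K. \<forall>x\<in>K. conjugation G g x = conjugation G k x)" (is "_ \<longleftrightarrow> ?R")
proof -
  interpret group_hom G Q \<pi> by fact
  interpret normal K G unfolding K by (rule normal_kernel)
  have "\<pi> g \<in> ker_FC_coupling G K Q \<pi> \<longleftrightarrow>
      coupling G K \<pi> (\<pi> g) = Inn (G\<lparr>carrier := K\<rparr>)"
    using g by (simp add: ker_FC_coupling_def kernel_def FC_coupling_def Out_def FactGroup_def)
  also have "\<dots> \<longleftrightarrow>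
     (\<lambda>y. \<lambda>x\<in>K. conjugation G (y \<otimes>\<^bsub>G\<^esub> g) x) ` K = (\<lambda>y. \<lambda>x\<in>K. conjugation G y x) ` K"
    unfolding coupling_eq[OF h K g(1)] Inn_coset[OF g(1)] unfolding Inn_subgroup ..
  also have "\<dots> \<longleftrightarrow> ?R"
  proof
    assume A: "(\<lambda>y. \<lambda>x\<in>K. conjugation G (y \<otimes>\<^bsub>G\<^esub> g) x) ` K = (\<lambda>y. \<lambda>x\<in>K. conjugation G y x) ` K"
    have "(\<lambda>x\<in>K. conjugation G (\<one>\<^bsub>G\<^esub> \<otimes>\<^bsub>G\<^esub> g) x) \<in> (\<lambda>y. \<lambda>x\<in>K. conjugation G y x) ` K"
      unfolding A[symmetric] by (rule imageI) (rule one_closed)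
    then obtain k where k: "k \<in> K" "(\<lambda>x\<in>K. conjugation G g x) = (\<lambda>x\<in>K. conjugation G k x)"
      using g by auto
    have "conjugation G g x = conjugation G k x" if "x \<in> K" for x
      using fun_cong[OF k(2), of x] that by simp
    with k(1) show ?R by blast
  next
    assume ?R
    then obtain k where k: "k \<in> K" "\<And>x. x \<in> K \<Longrightarrow> conjugation G g x = conjugation G k x" by blast
    have "(\<lambda>y. y \<otimes>\<^bsub>G\<^esub> k) ` K = K"
      by (rule image_mult_right[OF k(1)])
    then have "(\<lambda>y. \<lambda>x\<in>K. conjugation G y x) ` K = 
       (\<lambda>y. \<lambda>x\<in>K. conjugation G y x) ` (\<lambda>y. y \<otimes>\<^bsub>G\<^esub> k) ` K" by simp
    also have "\<dots> = (\<lambda>y. \<lambda>x\<in>K. conjugation G (y \<otimes>\<^bsub>G\<^esub> g) x) ` K"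
      unfolding image_image
    proof (intro image_cong refl restrict_ext)
      fix y x assume "y \<in> K" "x \<in> K"
      then show "conjugation G (y \<otimes>\<^bsub>G\<^esub> k) x = conjugation G (y \<otimes>\<^bsub>G\<^esub> g) x"
        using k g(1) G.conjugation_comp[of y k x] G.conjugation_comp[of y g x] by (metis mem_carrier)
    qed
    finally show "(\<lambda>y. \<lambda>x\<in>K. conjugation G (y \<otimes>\<^bsub>G\<^esub> g) x) ` K = (\<lambda>y. \<lambda>x\<in>K. conjugation G y x) ` K" by simp
  qed
  finally show ?thesis .
qed

text \<open>The construction of \<open>\<Xi>\<close> is meaningful: \<open>Xi_hom\<close> shows that its values lie in \<open>H1\<close> and
  that it is a group homomorphism. The proof rests on the element \<open>c = inv (k q) \<otimes> s q\<close>, which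
  centralizes \<open>K\<close>, and on the identity \<open>Xi_cocycle G Q s k q u = inv (conjugation G (s u) c) \<otimes> c\<close>.\<close>

locale chosen_extension =
  fixes G :: "('a, 'm) monoid_scheme" and Q :: "('b, 'n) monoid_scheme"
    and K :: "'a set" and \<pi> :: "'a \<Rightarrow> 'b" and s k :: "'b \<Rightarrow> 'a"
  assumes h: "group_hom G Q \<pi>" and K: "K = kernel G Q \<pi>"
    and s: "set_section G Q \<pi> s" and k: "kernel_choice G K Q \<pi> s k"
begin

interpretation group_hom G Q \<pi> by (rule h)
interpretation normal K G unfolding K by (rule normal_kernel)

abbreviation (input) "Z \<equiv> center (G\<lparr>carrier := K\<rparr>)"
abbreviation (input) "P \<equiv> centralizer Q (FC Q)"
abbreviation (input) "D \<equiv> cocycle_group G Z Q s P"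
abbreviation (input) "B \<equiv> coboundaries G Z s P"
abbreviation (input) "b c \<equiv> (\<lambda>u\<in>P. inv\<^bsub>G\<^esub> (conjugation G (s u) c) \<otimes>\<^bsub>G\<^esub> c)"

lemma K_iff: "x \<in> K \<longleftrightarrow> x \<in> carrier G \<and> \<pi> x = \<one>\<^bsub>Q\<^esub>"
  unfolding K kernel_def by simp

lemma Z_iff: "z \<in> Z \<longleftrightarrow> z \<in> K \<and> z \<in> centralizer G K"
  by (auto simp: center_def centralizer_def)

lemma subgroup_centralizer_K: "subgroup (centralizer G K) G"
  using subset by (rule G.subgroup_centralizer)

lemma conjugation_centralizer_K:
  assumes g: "g \<in> carrier G" and c: "c \<in> centralizer G K"
  shows "conjugation G g c \<in> centralizer G K"
proof -
  have cc: "c \<in> carrier G" using c by (simp add: centralizer_def)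
  have "conjugation G g c \<otimes>\<^bsub>G\<^esub> x = x \<otimes>\<^bsub>G\<^esub> conjugation G g c" if x: "x \<in> K" for x
  proof -
    define y where "y = conjugation G (inv\<^bsub>G\<^esub> g) x"
    have y: "y \<in> K" using conjugation_in[of "inv\<^bsub>G\<^esub> g" x] g x by (simp add: y_def)
    have xy: "x = conjugation G g y"
      unfolding y_def using g x by (simp add: G.conjugation_comp[symmetric] G.conjugation_one)
    show ?thesis unfolding xy using g cc y c
      by (simp add: G.conjugation_mult[symmetric] centralizer_def)
  qed
  then show ?thesis using g cc by (simp add: centralizer_def G.conjugation_closed)
qed

lemma s_closed: "u \<in> carrier Q \<Longrightarrow> s u \<in> carrier G" and pi_s: "u \<in> carrier Q \<Longrightarrow> \<pi> (s u) = u"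
  using s by (auto simp: set_section_def)

lemma subgroup_Z: "subgroup Z G"
proof -
  have "Z = centralizer G K \<inter> K"
    by (auto simp: Z_iff)
  then show ?thesis
    using G.subgroups_Inter_pair[OF subgroup_centralizer_K subgroup_axioms] by simp
qed

lemma s_comp:
  assumes "u \<in> carrier Q" "v \<in> carrier Q" "c \<in> centralizer G K"
  shows "conjugation G (s (u \<otimes>\<^bsub>Q\<^esub> v)) c = conjugation G (s u) (conjugation G (s v) c)"
proof -
  have cc: "c \<in> carrier G" using assms by (simp add: centralizer_def)
  have sc: "s u \<in> carrier G" "s v \<in> carrier G" "s (u \<otimes>\<^bsub>Q\<^esub> v) \<in> carrier G" using assms s_closed by auto
  have "\<pi> (s (u \<otimes>\<^bsub>Q\<^esub> v)) = \<pi> (s u \<otimes>\<^bsub>G\<^esub> s v)" using assms sc pi_s by simp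
  then obtain x where x: "x \<in> K" "s (u \<otimes>\<^bsub>Q\<^esub> v) = x \<otimes>\<^bsub>G\<^esub> (s u \<otimes>\<^bsub>G\<^esub> s v)"
    using surj_kernel_fibre[of "s (u \<otimes>\<^bsub>Q\<^esub> v)" "s u \<otimes>\<^bsub>G\<^esub> s v", folded K] sc by auto
  let ?w = "conjugation G (s u) (conjugation G (s v) c)"
  have w: "?w \<in> centralizer G K" using sc assms conjugation_centralizer_K by auto
  have "conjugation G (s (u \<otimes>\<^bsub>Q\<^esub> v)) c = conjugation G x ?w"
    using x sc cc by (simp add: G.conjugation_comp G.conjugation_closed)
  also have "\<dots> = ?w"
    using w x(1) by (subst G.conjugation_eq_self_iff) (auto simp: centralizer_def)
  finally show ?thesis .
qed

lemma P_closed: "u \<in> P \<Longrightarrow> u \<in> carrier Q" by (simp add: centralizer_def)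

lemma P_mult: "u \<in> P \<Longrightarrow> v \<in> P \<Longrightarrow> u \<otimes>\<^bsub>Q\<^esub> v \<in> P"
  by (rule subgroup.m_closed[OF H.subgroup_centralizer]) (auto simp: FC_def FC_in_def)

lemma Z_cen: "z \<in> Z \<Longrightarrow> z \<in> centralizer G K" by (simp add: Z_iff)
lemma Z_closed: "z \<in> Z \<Longrightarrow> z \<in> carrier G" by (simp add: Z_iff centralizer_def)
lemma Z_commute: "z \<in> Z \<Longrightarrow> c \<in> centralizer G K \<Longrightarrow> z \<otimes>\<^bsub>G\<^esub> c = c \<otimes>\<^bsub>G\<^esub> z"
  by (simp add: Z_iff centralizer_def)
lemma Z_conj: "z \<in> Z \<Longrightarrow> u \<in> P \<Longrightarrow> conjugation G (s u) z \<in> Z"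
  using conjugation_in conjugation_centralizer_K s_closed P_closed by (simp add: Z_iff)

lemma comm_group_D: "comm_group D"
proof (rule comm_groupI)
  note [simp] = Z_conj Z_closed subgroup.m_closed[OF subgroup_Z] subgroup.one_closed[OF subgroup_Z]
     subgroup.m_inv_closed[OF subgroup_Z] P_mult P_closed s_closed G.conjugation_closed PiE_mem
  fix f g assume f: "f \<in> carrier D" and g: "g \<in> carrier D"
  have ff: "f u \<in> Z" and gg: "g u \<in> Z" if "u \<in> P" for u
    using that f g by (auto simp: cocycle_group_def)
  have "f (u \<otimes>\<^bsub>Q\<^esub> v) \<otimes>\<^bsub>G\<^esub> g (u \<otimes>\<^bsub>Q\<^esub> v) = f u \<otimes>\<^bsub>G\<^esub> g u \<otimes>\<^bsub>G\<^esub> conjugation G (s u) (f v \<otimes>\<^bsub>G\<^esub> g v)"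
    if uv: "u \<in> P" "v \<in> P" for u v
  proof -
    have "f (u \<otimes>\<^bsub>Q\<^esub> v) \<otimes>\<^bsub>G\<^esub> g (u \<otimes>\<^bsub>Q\<^esub> v) =
      f u \<otimes>\<^bsub>G\<^esub> conjugation G (s u) (f v) \<otimes>\<^bsub>G\<^esub> (g u \<otimes>\<^bsub>G\<^esub> conjugation G (s u) (g v))"
      using f g uv by (simp add: cocycle_group_def)
    also have "\<dots> = f u \<otimes>\<^bsub>G\<^esub> (conjugation G (s u) (f v) \<otimes>\<^bsub>G\<^esub> g u) \<otimes>\<^bsub>G\<^esub> conjugation G (s u) (g v)"
      using uv ff gg by (simp add: G.m_assoc)
    also have "\<dots> = f u \<otimes>\<^bsub>G\<^esub> (g u \<otimes>\<^bsub>G\<^esub> conjugation G (s u) (f v)) \<otimes>\<^bsub>G\<^esub> conjugation G (s u) (g v)"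
      using Z_commute[of "g u" "conjugation G (s u) (f v)"] uv ff gg Z_cen by simp
    finally show ?thesis using uv ff gg by (simp add: G.m_assoc G.conjugation_mult)
  qed
  then show "f \<otimes>\<^bsub>D\<^esub> g \<in> carrier D"
    using ff gg by (simp add: cocycle_group_def)
  show "f \<otimes>\<^bsub>D\<^esub> g = g \<otimes>\<^bsub>D\<^esub> f"
    using ff gg Z_commute Z_cen by (auto simp: cocycle_group_def intro!: restrict_ext)
  fix e assume e: "e \<in> carrier D"
  then have ee: "e u \<in> Z" if "u \<in> P" for u
    using that by (auto simp: cocycle_group_def)
  show "f \<otimes>\<^bsub>D\<^esub> g \<otimes>\<^bsub>D\<^esub> e = f \<otimes>\<^bsub>D\<^esub> (g \<otimes>\<^bsub>D\<^esub> e)"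
    using ff gg ee by (auto simp: cocycle_group_def G.m_assoc intro!: restrict_ext)
next
  show "\<one>\<^bsub>D\<^esub> \<in> carrier D"
    using subgroup.one_closed[OF subgroup_Z] P_mult s_closed P_closed 
    by (simp add: cocycle_group_def conjugation_def)
next
  fix f assume f: "f \<in> carrier D"
  then have ff: "f u \<in> Z" if "u \<in> P" for u using that by (auto simp: cocycle_group_def)
  show "\<one>\<^bsub>D\<^esub> \<otimes>\<^bsub>D\<^esub> f = f"
    using f ff Z_closed by (auto simp: cocycle_group_def fun_eq_iff PiE_def extensional_def)
  let ?g = "\<lambda>u\<in>P. inv\<^bsub>G\<^esub> (f u)"
  have "inv\<^bsub>G\<^esub> (f (u \<otimes>\<^bsub>Q\<^esub> v)) = inv\<^bsub>G\<^esub> (f u) \<otimes>\<^bsub>G\<^esub> conjugation G (s u) (inv\<^bsub>G\<^esub> (f v))"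
    if uv: "u \<in> P" "v \<in> P" for u v
  proof -
    note [simp] = Z_closed s_closed P_closed
    have "f (u \<otimes>\<^bsub>Q\<^esub> v) = conjugation G (s u) (f v) \<otimes>\<^bsub>G\<^esub> f u"
      using f uv Z_commute[of "f u" "conjugation G (s u) (f v)"] ff Z_conj Z_cen
      by (simp add: cocycle_group_def)
    moreover have "inv\<^bsub>G\<^esub> (conjugation G (s u) (f v)) = conjugation G (s u) (inv\<^bsub>G\<^esub> (f v))"
      using uv ff by (simp add: conjugation_def G.inv_mult_group G.m_assoc)
    ultimately show ?thesis using uv ff by (simp add: G.inv_mult_group G.conjugation_closed)
  qed
  then have "?g \<in> carrier D"
    using ff P_mult subgroup.m_inv_closed[OF subgroup_Z] by (simp add: cocycle_group_def)
  moreover have "?g \<otimes>\<^bsub>D\<^esub> f = \<one>\<^bsub>D\<^esub>"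
    using ff Z_closed by (auto simp: cocycle_group_def intro!: restrict_ext)
  ultimately show "\<exists>g\<in>carrier D. g \<otimes>\<^bsub>D\<^esub> f = \<one>\<^bsub>D\<^esub>" by blast
qed

lemma b_cocycle:
  assumes c: "c \<in> centralizer G K" "\<pi> c \<in> FC Q"
  shows "b c \<in> carrier D"
proof -
  note [simp] = P_closed s_closed G.conjugation_closed
  have cc[simp]: "c \<in> carrier G" using c by (simp add: centralizer_def)
  have Z: "inv\<^bsub>G\<^esub> (conjugation G (s u) c) \<otimes>\<^bsub>G\<^esub> c \<in> Z" if u: "u \<in> P" for u
  proof -
    have "u \<otimes>\<^bsub>Q\<^esub> \<pi> c = \<pi> c \<otimes>\<^bsub>Q\<^esub> u"
      using u c(2) unfolding centralizer_def by blast
    then have "\<pi> (conjugation G (s u) c) = \<pi> c"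
      using u pi_s[of u] by (simp add: conjugation_def H.m_assoc)
    then have "\<pi> (inv\<^bsub>G\<^esub> (conjugation G (s u) c) \<otimes>\<^bsub>G\<^esub> c) = \<one>\<^bsub>Q\<^esub>" using u by simp
    moreover have "inv\<^bsub>G\<^esub> (conjugation G (s u) c) \<otimes>\<^bsub>G\<^esub> c \<in> centralizer G K"
      using u c conjugation_centralizer_K subgroup_centralizer_K
      by (simp add: subgroup.m_closed subgroup.m_inv_closed)
    ultimately show ?thesis using u unfolding Z_iff K_iff by simp
  qed
  have "inv\<^bsub>G\<^esub> (conjugation G (s (u \<otimes>\<^bsub>Q\<^esub> v)) c) \<otimes>\<^bsub>G\<^esub> c =
      inv\<^bsub>G\<^esub> (conjugation G (s u) c) \<otimes>\<^bsub>G\<^esub> c \<otimes>\<^bsub>G\<^esub> conjugation G (s u) (inv\<^bsub>G\<^esub> (conjugation G (s v) c) \<otimes>\<^bsub>G\<^esub> c)"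
    if uv: "u \<in> P" "v \<in> P" for u v
  proof -
    define a where "a = conjugation G (s u) c"
    define e where "e = conjugation G (s u) (conjugation G (s v) c)"
    have [simp]: "a \<in> carrier G" "e \<in> carrier G" using uv by (auto simp: a_def e_def)
    have ie: "conjugation G (s u) (inv\<^bsub>G\<^esub> (conjugation G (s v) c)) = inv\<^bsub>G\<^esub> e"
      using uv by (simp add: e_def conjugation_def[of G "s u"] G.inv_mult_group G.m_assoc)
    have "conjugation G (s u) (inv\<^bsub>G\<^esub> (conjugation G (s v) c) \<otimes>\<^bsub>G\<^esub> c) = inv\<^bsub>G\<^esub> e \<otimes>\<^bsub>G\<^esub> a"
      using uv by (simp add: G.conjugation_mult ie a_def)
    moreover have "inv\<^bsub>G\<^esub> a \<otimes>\<^bsub>G\<^esub> c \<otimes>\<^bsub>G\<^esub> (inv\<^bsub>G\<^esub> e \<otimes>\<^bsub>G\<^esub> a) = (inv\<^bsub>G\<^esub> e \<otimes>\<^bsub>G\<^esub> a) \<otimes>\<^bsub>G\<^esub> (inv\<^bsub>G\<^esub> a \<otimes>\<^bsub>G\<^esub> c)"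
    proof (rule Z_commute)
      show "inv\<^bsub>G\<^esub> a \<otimes>\<^bsub>G\<^esub> c \<in> Z" using Z[OF uv(1)] by (simp add: a_def)
      show "inv\<^bsub>G\<^esub> e \<otimes>\<^bsub>G\<^esub> a \<in> centralizer G K"
        using uv c conjugation_centralizer_K subgroup_centralizer_K
        by (simp add: subgroup.m_closed subgroup.m_inv_closed a_def e_def)
    qed
    moreover have "\<dots> = inv\<^bsub>G\<^esub> e \<otimes>\<^bsub>G\<^esub> c"
      by (simp add: G.m_assoc) (simp add: G.m_assoc[symmetric])
    ultimately show ?thesis using uv c by (simp add: s_comp a_def e_def)
  qed
  then show ?thesis using Z P_mult by (simp add: cocycle_group_def)
qed

lemma b_mult:
  assumes c: "c \<in> centralizer G K" "\<pi> c \<in> FC Q" and c': "c' \<in> centralizer G K" "\<pi> c' \<in> FC Q"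
  shows "b (c \<otimes>\<^bsub>G\<^esub> c') = b c \<otimes>\<^bsub>D\<^esub> b c'"
proof -
  note [simp] = P_closed s_closed G.conjugation_closed
  have [simp]: "c \<in> carrier G" "c' \<in> carrier G" using c c' by (auto simp: centralizer_def)
  have "inv\<^bsub>G\<^esub> (conjugation G (s u) (c \<otimes>\<^bsub>G\<^esub> c')) \<otimes>\<^bsub>G\<^esub> (c \<otimes>\<^bsub>G\<^esub> c') =
    inv\<^bsub>G\<^esub> (conjugation G (s u) c) \<otimes>\<^bsub>G\<^esub> c \<otimes>\<^bsub>G\<^esub> (inv\<^bsub>G\<^esub> (conjugation G (s u) c') \<otimes>\<^bsub>G\<^esub> c')" if u: "u \<in> P" for u
  proof -
    let ?a = "inv\<^bsub>G\<^esub> (conjugation G (s u) c)" and ?a' = "inv\<^bsub>G\<^esub> (conjugation G (s u) c')"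
    have Z: "?a \<otimes>\<^bsub>G\<^esub> c \<in> Z" using b_cocycle[OF c] u by (force simp: cocycle_group_def)
    have [simp]: "?a \<in> carrier G" "?a' \<in> carrier G" using u by auto
    have a': "?a' \<in> centralizer G K" 
      using u c' conjugation_centralizer_K subgroup_centralizer_K by (simp add: subgroup.m_inv_closed)
    have "inv\<^bsub>G\<^esub> (conjugation G (s u) (c \<otimes>\<^bsub>G\<^esub> c')) \<otimes>\<^bsub>G\<^esub> (c \<otimes>\<^bsub>G\<^esub> c') = ?a' \<otimes>\<^bsub>G\<^esub> (?a \<otimes>\<^bsub>G\<^esub> c) \<otimes>\<^bsub>G\<^esub> c'"
      using u by (simp add: G.conjugation_mult G.inv_mult_group G.m_assoc)
    also have "\<dots> = (?a \<otimes>\<^bsub>G\<^esub> c) \<otimes>\<^bsub>G\<^esub> ?a' \<otimes>\<^bsub>G\<^esub> c'" using Z_commute[OF Z a'] by simp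
    finally show ?thesis by (simp add: G.m_assoc)
  qed
  then show ?thesis by (auto simp: cocycle_group_def intro!: restrict_ext)
qed

lemma FC_one: "\<one>\<^bsub>Q\<^esub> \<in> FC Q"
proof -
  have "conjugacy_class Q \<one>\<^bsub>Q\<^esub> \<subseteq> {\<one>\<^bsub>Q\<^esub>}"
    by (auto simp: conjugacy_class_def orbit_def conjugation_def)
  then show ?thesis by (auto simp: FC_def FC_in_def dest: finite_subset)
qed

lemma Z_FC: "z \<in> Z \<Longrightarrow> \<pi> z \<in> FC Q"
  using FC_one by (simp add: Z_iff K_iff)

lemma coboundaries_eq: "B = (\<lambda>z. b z) ` Z"
proof -
  note [simp] = P_closed s_closed G.conjugation_closed Z_closed
  have *: "b (inv\<^bsub>G\<^esub> z) = (\<lambda>u\<in>P. inv\<^bsub>G\<^esub> z \<otimes>\<^bsub>G\<^esub> conjugation G (s u) z)" if z: "z \<in> Z" for z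
  proof (rule restrict_ext)
    fix u assume u: "u \<in> P"
    have "inv\<^bsub>G\<^esub> (conjugation G (s u) (inv\<^bsub>G\<^esub> z)) = conjugation G (s u) z"
      using u z by (simp add: conjugation_def G.inv_mult_group G.m_assoc)
    then show "inv\<^bsub>G\<^esub> (conjugation G (s u) (inv\<^bsub>G\<^esub> z)) \<otimes>\<^bsub>G\<^esub> inv\<^bsub>G\<^esub> z = inv\<^bsub>G\<^esub> z \<otimes>\<^bsub>G\<^esub> conjugation G (s u) z"
      using Z_commute[of "conjugation G (s u) z" "inv\<^bsub>G\<^esub> z"] u z Z_conj Z_cen 
         subgroup.m_inv_closed[OF subgroup_Z] by simp
  qed
  have "(\<lambda>z. b z) ` Z = (\<lambda>z. b z) ` m_inv G ` Z"
    using subgroup.m_inv_closed[OF subgroup_Z] Z_closed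
    by (intro arg_cong[where f = "image _"]) (force intro: rev_image_eqI)
  then show ?thesis unfolding coboundaries_def using * by (simp add: image_image cong: image_cong_simp)
qed

lemma b_hom_Z: "(\<lambda>z. b z) \<in> hom (G\<lparr>carrier := Z\<rparr>) D"
  using b_cocycle b_mult Z_cen Z_FC by (auto simp: hom_def)

lemma normal_B: "normal B D"
proof -
  interpret D: comm_group D by (rule comm_group_D)
  interpret Z: group "G\<lparr>carrier := Z\<rparr>" by (rule subgroup.subgroup_is_group[OF subgroup_Z G.group_axioms])
  interpret bh: group_hom "G\<lparr>carrier := Z\<rparr>" D "\<lambda>z. b z"
    using b_hom_Z by unfold_locales
  have "subgroup B D" using bh.img_is_subgroup by (simp add: coboundaries_eq)
  then show ?thesis by (simp add: D.normal_iff_subgroup)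
qed

lemma Xi_hom:
  shows "Xi G K Q s k \<in> hom (Q\<lparr>carrier := ker_FC_coupling G K Q \<pi>\<rparr>) (H1 G Z Q s P)"
proof -
  interpret D: comm_group D by (rule comm_group_D)
  interpret B: normal B D by (rule normal_B)
  let ?N = "ker_FC_coupling G K Q \<pi>"
  define c where "c q = inv\<^bsub>G\<^esub> (k q) \<otimes>\<^bsub>G\<^esub> s q" for q
  note [simp] = P_closed s_closed G.conjugation_closed
  have NFC: "q \<in> FC Q" and NQ[simp]: "q \<in> carrier Q" and kK: "k q \<in> K" and kG[simp]: "k q \<in> carrier G"
    and keq: "\<And>x. x \<in> K \<Longrightarrow> conjugation G (s q) x = conjugation G (k q) x" if "q \<in> ?N" for q
    using that k by (auto simp: kernel_choice_def ker_FC_coupling_def kernel_def FC_def FC_in_def)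
  have cG[simp]: "c q \<in> carrier G" if "q \<in> ?N" for q using that by (simp add: c_def)
  have pc: "\<pi> (c q) = q" if "q \<in> ?N" for q
    using that kK[OF that] pi_s by (simp add: c_def K_iff)
  have cc: "c q \<in> centralizer G K" if q: "q \<in> ?N" for q
  proof -
    have "c q \<otimes>\<^bsub>G\<^esub> x = x \<otimes>\<^bsub>G\<^esub> c q" if x: "x \<in> K" for x
    proof -
      have "conjugation G (c q) x = x"
        using q x keq[OF q x] by (simp add: c_def G.conjugation_comp)
          (simp add: G.conjugation_comp[symmetric] G.conjugation_one)
      then show ?thesis using q x by (subst (asm) G.conjugation_eq_self_iff) auto
    qed
    then show ?thesis using q by (simp add: centralizer_def)
  qed
  have d: "Xi_cocycle G Q s k q = b (c q)" if q: "q \<in> ?N" for q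
    unfolding Xi_cocycle_def
  proof (rule restrict_ext)
    fix u assume u: "u \<in> P"
    let ?su = "s u" and ?k = "k q" and ?c = "c q"
    define a where "a = conjugation G ?su ?c"
    define kk where "kk = conjugation G ?su ?k"
    have [simp]: "a \<in> carrier G" "kk \<in> carrier G" using u q by (auto simp: a_def kk_def)
    have sq: "s q = ?k \<otimes>\<^bsub>G\<^esub> ?c" using q by (simp add: c_def G.m_assoc[symmetric])
    have kc: "?k \<otimes>\<^bsub>G\<^esub> ?c = ?c \<otimes>\<^bsub>G\<^esub> ?k" using cc[OF q] kK[OF q] by (simp add: centralizer_def)
    have 1: "inv\<^bsub>G\<^esub> (inv\<^bsub>G\<^esub> (s q) \<otimes>\<^bsub>G\<^esub> conjugation G ?su (s q)) = inv\<^bsub>G\<^esub> a \<otimes>\<^bsub>G\<^esub> inv\<^bsub>G\<^esub> kk \<otimes>\<^bsub>G\<^esub> (?c \<otimes>\<^bsub>G\<^esub> ?k)"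
      using u q by (simp add: sq G.conjugation_mult G.inv_mult_group a_def[symmetric] kk_def[symmetric] kc[symmetric])
    have kkK: "kk \<in> K" using kK[OF q] conjugation_in u by (simp add: kk_def)
    have "inv\<^bsub>G\<^esub> (inv\<^bsub>G\<^esub> (s q) \<otimes>\<^bsub>G\<^esub> conjugation G ?su (s q)) \<otimes>\<^bsub>G\<^esub> inv\<^bsub>G\<^esub> ?k \<otimes>\<^bsub>G\<^esub> kk
      = inv\<^bsub>G\<^esub> a \<otimes>\<^bsub>G\<^esub> inv\<^bsub>G\<^esub> kk \<otimes>\<^bsub>G\<^esub> (?c \<otimes>\<^bsub>G\<^esub> kk)"
      unfolding 1 using q by (simp add: G.m_assoc)
    also have "?c \<otimes>\<^bsub>G\<^esub> kk = kk \<otimes>\<^bsub>G\<^esub> ?c" using cc[OF q] kkK by (simp add: centralizer_def)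
    also have "inv\<^bsub>G\<^esub> a \<otimes>\<^bsub>G\<^esub> inv\<^bsub>G\<^esub> kk \<otimes>\<^bsub>G\<^esub> (kk \<otimes>\<^bsub>G\<^esub> ?c) = inv\<^bsub>G\<^esub> a \<otimes>\<^bsub>G\<^esub> ?c"
      using q by (simp add: G.m_assoc) (simp add: G.m_assoc[symmetric])
    finally show "inv\<^bsub>G\<^esub> (inv\<^bsub>G\<^esub> (s q) \<otimes>\<^bsub>G\<^esub> conjugation G ?su (s q)) \<otimes>\<^bsub>G\<^esub> inv\<^bsub>G\<^esub> ?k \<otimes>\<^bsub>G\<^esub> conjugation G ?su ?k
       = inv\<^bsub>G\<^esub> (conjugation G ?su ?c) \<otimes>\<^bsub>G\<^esub> ?c" by (simp add: a_def kk_def)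
  qed
  have X: "Xi G K Q s k q = B #>\<^bsub>D\<^esub> b (c q)" if "q \<in> ?N" for q
    by (simp only: Xi_def Let_def d[OF that])
  have bc: "b (c q) \<in> carrier D" if "q \<in> ?N" for q
    using b_cocycle[OF cc[OF that]] pc[OF that] NFC[OF that] by simp
  have Nmult: "p \<otimes>\<^bsub>Q\<^esub> q \<in> ?N \<Longrightarrow> p \<in> ?N \<Longrightarrow> q \<in> ?N \<Longrightarrow>
      Xi G K Q s k (p \<otimes>\<^bsub>Q\<^esub> q) = Xi G K Q s k p \<otimes>\<^bsub>H1 G Z Q s P\<^esub> Xi G K Q s k q" for p q
  proof -
    assume pq: "p \<otimes>\<^bsub>Q\<^esub> q \<in> ?N" and p: "p \<in> ?N" and q: "q \<in> ?N"
    obtain z where z: "z \<in> K" "c (p \<otimes>\<^bsub>Q\<^esub> q) = z \<otimes>\<^bsub>G\<^esub> (c p \<otimes>\<^bsub>G\<^esub> c q)"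
      using surj_kernel_fibre[of "c (p \<otimes>\<^bsub>Q\<^esub> q)" "c p \<otimes>\<^bsub>G\<^esub> c q", folded K] pc pq p q by auto
    have zeq: "z = c (p \<otimes>\<^bsub>Q\<^esub> q) \<otimes>\<^bsub>G\<^esub> inv\<^bsub>G\<^esub> (c p \<otimes>\<^bsub>G\<^esub> c q)"
      using z p q pq mem_carrier by (simp add: G.m_assoc)
    have zz: "z \<in> Z" unfolding Z_iff
      using z(1) zeq cc pq p q subgroup_centralizer_K by (simp add: subgroup.m_closed subgroup.m_inv_closed)
    have ccc: "c p \<otimes>\<^bsub>G\<^esub> c q \<in> centralizer G K"
      using cc p q subgroup_centralizer_K by (simp add: subgroup.m_closed)
    have "b (c (p \<otimes>\<^bsub>Q\<^esub> q)) = b z \<otimes>\<^bsub>D\<^esub> b (c p \<otimes>\<^bsub>G\<^esub> c q)"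
      unfolding z(2) using b_mult[OF Z_cen[OF zz] Z_FC[OF zz] ccc] pc p q NFC[OF pq] by simp
    also have "b (c p \<otimes>\<^bsub>G\<^esub> c q) = b (c p) \<otimes>\<^bsub>D\<^esub> b (c q)"
      using b_mult cc pc NFC p q by simp
    finally have e: "b (c (p \<otimes>\<^bsub>Q\<^esub> q)) = b z \<otimes>\<^bsub>D\<^esub> (b (c p) \<otimes>\<^bsub>D\<^esub> b (c q))" .
    have bz: "b z \<in> B" unfolding coboundaries_eq using zz by blast
    have "B #>\<^bsub>D\<^esub> b (c (p \<otimes>\<^bsub>Q\<^esub> q)) = B #>\<^bsub>D\<^esub> b z #>\<^bsub>D\<^esub> (b (c p) \<otimes>\<^bsub>D\<^esub> b (c q))"
      unfolding e using D.coset_mult_assoc[OF B.subset, of "b z" "b (c p) \<otimes>\<^bsub>D\<^esub> b (c q)"] bz B.mem_carrier bc p q by simp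
    also have "B #>\<^bsub>D\<^esub> b z = B" using B.rcos_const[OF D.group_axioms bz] .
    finally have E: "B #>\<^bsub>D\<^esub> b (c (p \<otimes>\<^bsub>Q\<^esub> q)) = B #>\<^bsub>D\<^esub> (b (c p) \<otimes>\<^bsub>D\<^esub> b (c q))" .
    show ?thesis
      unfolding X[OF pq] X[OF p] X[OF q] H1_def FactGroup_def
      by (simp only: monoid.select_convs B.rcos_sum[OF bc[OF p] bc[OF q]] E)
  qed
  have "p \<otimes>\<^bsub>Q\<^esub> q \<in> ?N" if p: "p \<in> ?N" and q: "q \<in> ?N" for p q
  proof -
    have "conjugacy_class Q (p \<otimes>\<^bsub>Q\<^esub> q) \<subseteq>
        (\<lambda>(x, y). x \<otimes>\<^bsub>Q\<^esub> y) ` (conjugacy_class Q p \<times> conjugacy_class Q q)"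
      using p q by (force simp: conjugacy_class_def orbit_def H.conjugation_mult)
    then have FCpq: "p \<otimes>\<^bsub>Q\<^esub> q \<in> FC Q"
      using NFC[OF p] NFC[OF q] p q
      by (auto simp: FC_def FC_in_def intro: finite_subset)
    have "\<pi> (s p \<otimes>\<^bsub>G\<^esub> s q) \<in> ?N"
    proof (subst ker_FC_coupling_iff[OF h K])
      show "\<exists>k\<in>K. \<forall>x\<in>K. conjugation G (s p \<otimes>\<^bsub>G\<^esub> s q) x = conjugation G k x"
        using p q kK keq conjugation_in mem_carrier
        by (intro bexI[of _ "k p \<otimes>\<^bsub>G\<^esub> k q"]) (auto simp: G.conjugation_comp)
    qed (use p q FCpq pi_s in auto)
    then show ?thesis using p q pi_s by simp
  qed
  moreover have "Xi G K Q s k q \<in> carrier (H1 G Z Q s P)" if q: "q \<in> ?N" for q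
    unfolding X[OF q] H1_def FactGroup_def RCOSETS_def using bc[OF q] by auto
  ultimately show ?thesis
    using Nmult by (intro homI) simp_all
qed

end

end

theory Submission
  imports Defs
begin

text \<open>Since \<open>G\<close> is nontrivial, it is icc iff only the identity has a finite conjugacy class. Every
  \<open>q\<close> in the kernel of \<open>\<Phi>\<close> lifts to some \<open>x\<close> centralizing \<open>K\<close>, and \<open>\<Xi>(q)\<close> is the class of the
  cocycle \<open>u \<mapsto> (s(u) x s(u)\<^sup>-\<^sup>1)\<^sup>-\<^sup>1 x\<close>, whatever lift \<open>x\<close> is used.

  If \<open>\<Xi>(\<pi> x) = \<Xi>(\<pi> y)\<close>, then after correcting \<open>y\<close> by an element of \<open>Z\<close> the element \<open>x y\<^sup>-\<^sup>1\<close>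
  commutes with \<open>K\<close> and with all lifts of elements of \<open>C\<^sub>Q(FC(Q))\<close>; as this centralizer has finite
  index, \<open>x y\<^sup>-\<^sup>1\<close> has a finite conjugacy class. Conversely, if \<open>g\<close> has a finite conjugacy class, so
  do its commutators, and those lying in \<open>K\<close> vanish by (i); hence \<open>g\<close> centralizes \<open>K\<close> and its
  cocycle is trivial, so that \<open>\<pi> g = 1\<close> by injectivity and \<open>g = 1\<close> by (i).\<close>

section \<open>Finite conjugacy classes in an arbitrary group\<close>

text \<open>Choosing preimages under \<open>f\<close> makes \<open>g\<close> factor through
  \<open>f\<close>. This serves both to bound an index by numbers of conjugates and to bound a
  number of conjugates by an index.\<close>

lemma finite_image_factor:
  assumes "finite (f ` A)"
    and factor: "\<And>x y. x \<in> A \<Longrightarrow> y \<in> A \<Longrightarrow> f x = f y \<Longrightarrow> g x = g y"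
  shows "finite (g ` A)"
proof -
  have "g x = g (inv_into A f (f x))" if "x \<in> A" for x
    using that by (intro factor) (auto intro: inv_into_into simp: f_inv_into_f)
  then have "g ` A \<subseteq> (\<lambda>y. g (inv_into A f y)) ` f ` A"
    by (auto simp: image_image)
  then show ?thesis
    using assms(1) by (meson finite_imageI finite_subset)
qed

lemma conjugacy_class_image: "conjugacy_class G x = (\<lambda>g. conjugation G g x) ` carrier G"
  by (auto simp: conjugacy_class_def orbit_def)

lemma (in group) conjugation_inv:
  assumes "g \<in> carrier G" "x \<in> carrier G"
  shows "conjugation G g (inv x) = inv (conjugation G g x)"
  using assms by (simp add: conjugation_def inv_mult_group m_assoc)

lemma (in group) finite_conjugacy_class_mult:
  assumes "x \<in> carrier G" "y \<in> carrier G"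
    and "finite (conjugacy_class G x)" "finite (conjugacy_class G y)"
  shows "finite (conjugacy_class G (x \<otimes> y))"
proof (rule finite_subset)
  show "conjugacy_class G (x \<otimes> y)
      \<subseteq> (\<lambda>(a, b). a \<otimes> b) ` (conjugacy_class G x \<times> conjugacy_class G y)"
    using assms(1,2) by (force simp: conjugacy_class_image conjugation_mult)
qed (use assms in simp)

lemma (in group) finite_conjugacy_class_inv:
  assumes "x \<in> carrier G" "finite (conjugacy_class G x)"
  shows "finite (conjugacy_class G (inv x))"
proof (rule finite_subset)
  show "conjugacy_class G (inv x) \<subseteq> m_inv G ` conjugacy_class G x"
    using assms(1) by (auto simp: conjugacy_class_image conjugation_inv)
qed (use assms in simp)

lemma (in group) finite_conjugacy_class_conjugation:
  assumes "x \<in> carrier G" "h \<in> carrier G" "finite (conjugacy_class G x)"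
  shows "finite (conjugacy_class G (conjugation G h x))"
proof (rule finite_subset)
  show "conjugacy_class G (conjugation G h x) \<subseteq> conjugacy_class G x"
    using assms(1,2) by (auto simp: conjugacy_class_image conjugation_comp[symmetric])
qed (use assms in simp)

text \<open>By surjectivity every conjugate of \<open>h x\<close> is the image of a conjugate of
  \<open>x\<close>.\<close>

lemma (in group_hom) finite_conjugacy_class_hom:
  assumes surj: "h ` carrier G = carrier H" and x: "x \<in> carrier G"
    and fin: "finite (conjugacy_class G x)"
  shows "finite (conjugacy_class H (h x))"
proof -
  have "conjugacy_class H (h x) = h ` conjugacy_class G x"
    unfolding conjugacy_class_image surj[symmetric] image_image
    using x by (intro image_cong) (auto simp: conjugation_def)
  then show ?thesis using fin by simp
qed

text \<open>A single nontrivial element with an infinite class already makes the carrier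
  infinite.\<close>

lemma (in group) icc_iff:
  assumes "carrier G \<noteq> {\<one>}"
  shows "icc G \<longleftrightarrow> (\<forall>x\<in>carrier G. finite (conjugacy_class G x) \<longrightarrow> x = \<one>)"
proof -
  obtain x where x: "x \<in> carrier G" "x \<noteq> \<one>"
    using assms one_closed by blast
  have "conjugacy_class G x \<subseteq> carrier G"
    using x by (auto simp: conjugacy_class_image conjugation_closed)
  then show ?thesis
    using x unfolding icc_def by (meson finite_subset)
qed

lemma (in group) finite_conjugacy_class_one: "finite (conjugacy_class G \<one>)"
proof -
  have "conjugacy_class G \<one> \<subseteq> {\<one>}"
    by (auto simp: conjugacy_class_image conjugation_def)
  then show ?thesis
    by (rule finite_subset) simp
qed

section \<open>Right cosets and the index of the centralizer of \<open>FC\<close>\<close>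

lemma (in group) rcos_eq_iff:
  assumes "subgroup H G" "a \<in> carrier G" "b \<in> carrier G"
  shows "H #> a = H #> b \<longleftrightarrow> a \<otimes> inv b \<in> H"
proof
  assume "H #> a = H #> b"
  then have "a \<in> H #> b"
    using rcos_self[OF assms(2,1)] by simp
  then show "a \<otimes> inv b \<in> H"
    using assms subgroup.mem_carrier[OF assms(1)] by (auto simp: r_coset_def m_assoc)
next
  assume "a \<otimes> inv b \<in> H"
  then have "a \<in> H #> b"
    using assms by (auto simp: r_coset_def m_assoc intro!: bexI[of _ "a \<otimes> inv b"])
  then show "H #> a = H #> b"
    using repr_independence[OF _ assms(3,1)] by simp
qed

text \<open>The inverses fit right cosets: the conjugate of \<open>x\<close> by \<open>inv a\<close>
  determines, and is determined by, the right coset of \<open>a\<close> modulo the centralizer of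
  \<open>x\<close>.\<close>

lemma (in group) conjugation_inv_eq_iff:
  assumes "a \<in> carrier G" "b \<in> carrier G" "x \<in> carrier G"
  shows "conjugation G (inv a) x = conjugation G (inv b) x \<longleftrightarrow> (a \<otimes> inv b) \<otimes> x = x \<otimes> (a \<otimes> inv b)"
proof -
  have "conjugation G (inv a) x = conjugation G (inv b) x \<longleftrightarrow>
      conjugation G a (conjugation G (inv a) x) = conjugation G a (conjugation G (inv b) x)"
    using assms by (simp add: conjugation_eq_iff conjugation_closed)
  also have "\<dots> \<longleftrightarrow> conjugation G (a \<otimes> inv b) x = x"
    using assms by (auto simp: conjugation_comp[symmetric] conjugation_one)
  finally show ?thesis
    using assms by (simp add: conjugation_eq_self_iff)
qed

text \<open>The coset of \<open>a\<close> is determined by the conjugates of finitely many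
  generators by \<open>inv a\<close>, and each generator has only finitely many conjugates.\<close>

lemma (in group) finite_index_centralizer_FC:
  assumes "fin_gen_subgroup G (FC G)"
  shows "finite_index G (centralizer G (FC G))"
proof -
  obtain S where S: "finite S" "S \<subseteq> FC G" "generate G S = FC G"
    using assms by (auto simp: fin_gen_subgroup_def)
  have FC: "FC G \<subseteq> carrier G" "\<And>x. x \<in> FC G \<Longrightarrow> finite (conjugacy_class G x)"
    by (auto simp: FC_def FC_in_def)
  \<comment> \<open>Commuting with \<open>c\<close> passes from \<open>S\<close> to all of
    \<open>generate G S\<close>, because the centralizer of \<open>c\<close> is a subgroup.\<close>
  have cent: "c \<in> centralizer G (FC G)" if c: "c \<in> carrier G" "\<And>x. x \<in> S \<Longrightarrow> c \<otimes> x = x \<otimes> c" for c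
  proof -
    have "S \<subseteq> centralizer G {c}"
      using c S(2) FC by (auto simp: centralizer_def)
    then have "generate G S \<subseteq> centralizer G {c}"
      using c by (intro generate_subgroup_incl subgroup_centralizer) auto
    then show ?thesis
      using c S(3) by (auto simp: centralizer_def)
  qed
  have "finite ((\<lambda>a. centralizer G (FC G) #> a) ` carrier G)"
  proof (rule finite_image_factor)
    let ?f = "\<lambda>a. \<lambda>x\<in>S. conjugation G (inv a) x"
    have "?f ` carrier G \<subseteq> (\<Pi>\<^sub>E x\<in>S. conjugacy_class G x)"
      by (auto simp: conjugacy_class_image)
    moreover have "finite (\<Pi>\<^sub>E x\<in>S. conjugacy_class G x)"
      using S FC by (intro finite_PiE) auto
    ultimately show "finite (?f ` carrier G)"
      by (rule finite_subset)
    fix a b assume ab: "a \<in> carrier G" "b \<in> carrier G" and eq: "?f a = ?f b"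
    have "a \<otimes> inv b \<in> centralizer G (FC G)"
    proof (rule cent)
      fix x assume x: "x \<in> S"
      then have "conjugation G (inv a) x = conjugation G (inv b) x"
        using fun_cong[OF eq, of x] by simp
      then show "a \<otimes> inv b \<otimes> x = x \<otimes> (a \<otimes> inv b)"
        using conjugation_inv_eq_iff ab x S(2) FC(1) by blast
    qed (use ab in simp)
    then show "centralizer G (FC G) #> a = centralizer G (FC G) #> b"
      using rcos_eq_iff[OF subgroup_centralizer[OF FC(1)] ab] by simp
  qed
  then show ?thesis
    by (simp add: finite_index_def RCOSETS_def UNION_singleton_eq_range)
qed

section \<open>Lifts centralizing \<open>K\<close> and the value of \<open>Xi\<close>\<close>

context chosen_extension
begin

interpretation group_hom G Q \<pi> by (rule h)
interpretation normal K G unfolding K by (rule normal_kernel)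

text \<open>\<open>s q\<close> and \<open>k q\<close> induce the same automorphism of
  \<open>K\<close>, so their quotient \<open>c\<close> acts trivially on \<open>K\<close>; it still
  lies over \<open>q\<close> because \<open>k q\<close> is in the kernel of
  \<open>\<pi>\<close>.\<close>

lemma centralizer_lift:
  assumes "q \<in> ker_FC_coupling G K Q \<pi>"
  defines "c \<equiv> inv\<^bsub>G\<^esub> (k q) \<otimes>\<^bsub>G\<^esub> s q"
  shows "c \<in> centralizer G K" and "\<pi> c = q"
    and "Xi_cocycle G Q s k q = b c"
proof -
  have kK: "k q \<in> K" and keq: "\<And>x. x \<in> K \<Longrightarrow> conjugation G (s q) x = conjugation G (k q) x"
    and q: "q \<in> carrier Q"
    using assms(1) k
    by (auto simp: kernel_choice_def ker_FC_coupling_def kernel_def FC_def FC_in_def)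
  have [simp]: "k q \<in> carrier G" "s q \<in> carrier G" "c \<in> carrier G"
    using kK q s_closed by (auto simp: c_def)
  show "\<pi> c = q"
    using kK q pi_s by (simp add: c_def K_iff)
  have "c \<otimes>\<^bsub>G\<^esub> x = x \<otimes>\<^bsub>G\<^esub> c" if x: "x \<in> K" for x
  proof -
    have "conjugation G c x = conjugation G (inv\<^bsub>G\<^esub> (k q)) (conjugation G (k q) x)"
      using x keq[OF x] by (simp add: c_def G.conjugation_comp)
    also have "\<dots> = x"
      using x by (simp add: G.conjugation_comp[symmetric] G.conjugation_one)
    finally show ?thesis
      using x by (simp add: G.conjugation_eq_self_iff)
  qed
  then show cen: "c \<in> centralizer G K"
    by (simp add: centralizer_def)
  have "inv\<^bsub>G\<^esub> (inv\<^bsub>G\<^esub> (s q) \<otimes>\<^bsub>G\<^esub> conjugation G (s u) (s q)) \<otimes>\<^bsub>G\<^esub> inv\<^bsub>G\<^esub> (k q) \<otimes>\<^bsub>G\<^esub> conjugation G (s u) (k q)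
      = inv\<^bsub>G\<^esub> (conjugation G (s u) c) \<otimes>\<^bsub>G\<^esub> c" if u: "u \<in> P" for u
  proof -
    define d l where "d = conjugation G (s u) c" and "l = conjugation G (s u) (k q)"
    have su: "s u \<in> carrier G"
      using u P_closed s_closed by simp
    then have [simp]: "d \<in> carrier G" "l \<in> carrier G" and l: "l \<in> K"
      using kK conjugation_in by (auto simp: d_def l_def G.conjugation_closed)
    \<comment> \<open>Substituting \<open>k q \<otimes> c\<close> for \<open>s q\<close> in the
      cocycle, the factors \<open>k q\<close> and \<open>l\<close> cancel, since both lie in
      \<open>K\<close> and so commute with \<open>c\<close>.\<close>
    have sq: "s q = k q \<otimes>\<^bsub>G\<^esub> c"
      by (simp add: c_def G.m_assoc[symmetric])
    have kc: "k q \<otimes>\<^bsub>G\<^esub> c = c \<otimes>\<^bsub>G\<^esub> k q"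
      using cen kK by (simp add: centralizer_def)
    have "conjugation G (s u) (s q) = l \<otimes>\<^bsub>G\<^esub> d"
      using su by (simp add: sq G.conjugation_mult d_def l_def)
    moreover have "s q \<otimes>\<^bsub>G\<^esub> inv\<^bsub>G\<^esub> (k q) = c"
      using cen kK by (simp add: sq kc G.m_assoc)
    moreover have "inv\<^bsub>G\<^esub> l \<otimes>\<^bsub>G\<^esub> (c \<otimes>\<^bsub>G\<^esub> l) = c"
      using cen l by (simp add: centralizer_def G.m_assoc[symmetric])
    ultimately show ?thesis
      by (simp add: G.inv_mult_group G.m_assoc flip: d_def l_def)
  qed
  then show "Xi_cocycle G Q s k q = b c"
    unfolding Xi_cocycle_def by (rule restrict_ext)
qed

lemma ker_FC_coupling_subset_FC: "ker_FC_coupling G K Q \<pi> \<subseteq> FC Q"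
  by (auto simp: ker_FC_coupling_def kernel_def)

text \<open>Such an \<open>x\<close> acts on \<open>K\<close> like the identity element, so the
  kernel criterion holds with witness 1.\<close>

lemma centralizer_in_ker:
  assumes x: "x \<in> centralizer G K" and "\<pi> x \<in> FC Q"
  shows "\<pi> x \<in> ker_FC_coupling G K Q \<pi>"
proof -
  have "x \<in> carrier G"
    using x by (simp add: centralizer_def)
  moreover have "conjugation G x y = conjugation G \<one>\<^bsub>G\<^esub> y" if "y \<in> K" for y
    using that x by (auto simp: G.conjugation_one G.conjugation_eq_self_iff centralizer_def)
  ultimately show ?thesis
    using assms ker_FC_coupling_iff[OF h K] one_closed by blast
qed

text \<open>Two lifts centralizing \<open>K\<close> differ by an element of \<open>Z\<close>, which changes \<open>b\<close> by a coboundary.\<close>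

lemma Xi_lift:
  assumes x: "x \<in> centralizer G K" and FC: "\<pi> x \<in> FC Q"
  shows "Xi G K Q s k (\<pi> x) = B #>\<^bsub>D\<^esub> b x"
proof -
  interpret D: comm_group D by (rule comm_group_D)
  interpret B: normal B D by (rule normal_B)
  define c where "c = inv\<^bsub>G\<^esub> (k (\<pi> x)) \<otimes>\<^bsub>G\<^esub> s (\<pi> x)"
  have c: "c \<in> centralizer G K" "\<pi> c = \<pi> x" "Xi_cocycle G Q s k (\<pi> x) = b c"
    using centralizer_lift[OF centralizer_in_ker[OF assms]] by (auto simp: c_def)
  have [simp]: "x \<in> carrier G" "c \<in> carrier G"
    using x c(1) by (auto simp: centralizer_def)
  define z where "z = c \<otimes>\<^bsub>G\<^esub> inv\<^bsub>G\<^esub> x"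
  have "z \<in> centralizer G K"
    using c(1) x subgroup_centralizer_K
    by (simp add: z_def subgroup.m_closed subgroup.m_inv_closed)
  moreover have "\<pi> z = \<one>\<^bsub>Q\<^esub>"
    by (simp add: z_def c(2))
  ultimately have z: "z \<in> Z"
    by (simp add: Z_iff K_iff z_def)
  then have bz: "b z \<in> B"
    unfolding coboundaries_eq by (rule imageI)
  have "c = z \<otimes>\<^bsub>G\<^esub> x"
    by (simp add: z_def G.m_assoc)
  then have "b c = b z \<otimes>\<^bsub>D\<^esub> b x"
    using b_mult[OF Z_cen[OF z] Z_FC[OF z] x FC] by simp
  then have "B #>\<^bsub>D\<^esub> b c = B #>\<^bsub>D\<^esub> b z #>\<^bsub>D\<^esub> b x"
    using D.coset_mult_assoc[OF B.subset] B.mem_carrier[OF bz] b_cocycle[OF x FC] by simp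
  also have "\<dots> = B #>\<^bsub>D\<^esub> b x"
    using B.rcos_const[OF D.group_axioms bz] by simp
  finally show ?thesis
    by (simp only: Xi_def Let_def c(3))
qed

section \<open>Injectivity of \<open>Xi\<close> when only the identity has a finite class\<close>

text \<open>The centralizer of \<open>x\<close> contains \<open>K\<close> and the lifts of
  \<open>P\<close>, hence the whole preimage of \<open>P\<close>, so the conjugate of
  \<open>x\<close> by \<open>a\<close> depends only on the coset \<open>\<pi> a P\<close>.\<close>

lemma finite_conjugacy_class_centralizing:
  assumes idx: "finite_index Q P" and x: "x \<in> centralizer G K"
    and P: "\<And>u. u \<in> P \<Longrightarrow> conjugation G (s u) x = x"
  shows "finite (conjugacy_class G x)"
  unfolding conjugacy_class_image
proof (rule finite_image_factor)
  \<comment> \<open>The inverse turns the left coset of \<open>\<pi> a\<close> into a right coset,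
    the kind that \<open>finite_index\<close> counts.\<close>
  let ?f = "\<lambda>a. P #>\<^bsub>Q\<^esub> inv\<^bsub>Q\<^esub> (\<pi> a)"
  have sub: "subgroup P Q"
    by (rule H.subgroup_centralizer) (auto simp: FC_def FC_in_def)
  have xG[simp]: "x \<in> carrier G"
    using x by (simp add: centralizer_def)
  have "?f ` carrier G \<subseteq> rcosets\<^bsub>Q\<^esub> P"
    using subgroup.subset[OF sub] by (auto intro!: H.rcosetsI)
  then show "finite (?f ` carrier G)"
    using idx by (auto simp: finite_index_def intro: finite_subset)
  fix a b assume [simp]: "a \<in> carrier G" "b \<in> carrier G" and "?f a = ?f b"
  then have "inv\<^bsub>Q\<^esub> (\<pi> a) \<otimes>\<^bsub>Q\<^esub> \<pi> b \<in> P"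
    by (simp add: H.rcos_eq_iff[OF sub])
  then have u: "\<pi> (inv\<^bsub>G\<^esub> a \<otimes>\<^bsub>G\<^esub> b) \<in> P"
    by simp
  define u where "u = \<pi> (inv\<^bsub>G\<^esub> a \<otimes>\<^bsub>G\<^esub> b)"
  have uP: "u \<in> P" "s u \<in> carrier G" "\<pi> (s u) = u"
    using u P_closed s_closed pi_s by (auto simp: u_def simp del: hom_mult)
  \<comment> \<open>An element over \<open>u\<close> differs from \<open>s u\<close> by a factor in
    \<open>K\<close>; both factors fix \<open>x\<close>.\<close>
  obtain y where y: "y \<in> K" "inv\<^bsub>G\<^esub> a \<otimes>\<^bsub>G\<^esub> b = y \<otimes>\<^bsub>G\<^esub> s u"
    using surj_kernel_fibre[of "inv\<^bsub>G\<^esub> a \<otimes>\<^bsub>G\<^esub> b" "s u", folded K] uP(2,3) u_def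
    by (metis G.inv_closed G.m_closed \<open>a \<in> carrier G\<close> \<open>b \<in> carrier G\<close>)
  have "conjugation G (inv\<^bsub>G\<^esub> a \<otimes>\<^bsub>G\<^esub> b) x = conjugation G y x"
    using y uP P[OF uP(1)] by (simp add: G.conjugation_comp)
  also have "\<dots> = x"
    using x y by (auto simp: G.conjugation_eq_self_iff centralizer_def)
  finally have "conjugation G a (conjugation G (inv\<^bsub>G\<^esub> a \<otimes>\<^bsub>G\<^esub> b) x) = conjugation G a x"
    by simp
  then show "conjugation G a x = conjugation G b x"
    by (simp add: G.conjugation_comp[symmetric] G.m_assoc[symmetric])
qed

lemma inj_on_Xi:
  assumes idx: "finite_index Q P"
    and FC: "\<And>x. x \<in> carrier G \<Longrightarrow> finite (conjugacy_class G x) \<Longrightarrow> x = \<one>\<^bsub>G\<^esub>"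
  shows "inj_on (Xi G K Q s k) (ker_FC_coupling G K Q \<pi>)"
proof (rule inj_onI)
  interpret D: comm_group D by (rule comm_group_D)
  interpret B: normal B D by (rule normal_B)
  fix p q assume p: "p \<in> ker_FC_coupling G K Q \<pi>" and q: "q \<in> ker_FC_coupling G K Q \<pi>"
    and eq: "Xi G K Q s k p = Xi G K Q s k q"
  obtain x y where x: "x \<in> centralizer G K" "\<pi> x = p" and y: "y \<in> centralizer G K" "\<pi> y = q"
    using centralizer_lift[OF p] centralizer_lift[OF q] by blast
  have FCp: "\<pi> x \<in> FC Q" and FCq: "\<pi> y \<in> FC Q"
    using p q x y ker_FC_coupling_subset_FC by auto
  have "B #>\<^bsub>D\<^esub> b x = B #>\<^bsub>D\<^esub> b y"
    using eq Xi_lift[OF x(1) FCp] Xi_lift[OF y(1) FCq] x(2) y(2) by simp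
  then have "b x \<in> B #>\<^bsub>D\<^esub> b y"
    using D.rcos_self[OF b_cocycle[OF x(1) FCp] B.subgroup_axioms] by simp
  then obtain z where z: "z \<in> Z" "b x = b z \<otimes>\<^bsub>D\<^esub> b y"
    unfolding r_coset_def coboundaries_eq by blast
  \<comment> \<open>Absorbing the coboundary \<open>b z\<close> into the lift of \<open>q\<close>
    turns equality of classes into equality of the cocycles \<open>b x\<close> and
    \<open>b w\<close>.\<close>
  define w where "w = z \<otimes>\<^bsub>G\<^esub> y"
  have mem_cen: "v \<in> carrier G" if "v \<in> centralizer G K" for v
    using that by (simp add: centralizer_def)
  have w: "w \<in> centralizer G K" "\<pi> w = q"
    using z(1) y mem_cen
    by (auto simp: w_def subgroup.m_closed[OF subgroup_centralizer_K] Z_iff K_iff)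
  have bxw: "b x = b w"
    unfolding w_def z(2) using b_mult[OF Z_cen[OF z(1)] Z_FC[OF z(1)] y(1) FCq] by simp
  have [simp]: "x \<in> carrier G" "w \<in> carrier G"
    using x w by (auto simp: centralizer_def)
  have "conjugation G (s u) (x \<otimes>\<^bsub>G\<^esub> inv\<^bsub>G\<^esub> w) = x \<otimes>\<^bsub>G\<^esub> inv\<^bsub>G\<^esub> w" if u: "u \<in> P" for u
  proof -
    let ?x = "conjugation G (s u) x" and ?w = "conjugation G (s u) w"
    have su: "s u \<in> carrier G"
      using u P_closed s_closed by simp
    then have [simp]: "?x \<in> carrier G" "?w \<in> carrier G"
      by (auto simp: G.conjugation_closed)
    have "inv\<^bsub>G\<^esub> ?x \<otimes>\<^bsub>G\<^esub> x = inv\<^bsub>G\<^esub> ?w \<otimes>\<^bsub>G\<^esub> w"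
      using fun_cong[OF bxw, of u] u by simp
    \<comment> \<open>Multiplying by \<open>?x\<close> on the left and \<open>inv w\<close> on the
      right separates the conjugated factors from the others: the result says that
      \<open>s u\<close> fixes \<open>x \<otimes> inv w\<close>.\<close>
    then have "?x \<otimes>\<^bsub>G\<^esub> (inv\<^bsub>G\<^esub> ?x \<otimes>\<^bsub>G\<^esub> x) = ?x \<otimes>\<^bsub>G\<^esub> (inv\<^bsub>G\<^esub> ?w \<otimes>\<^bsub>G\<^esub> w)"
      by simp
    then have "x \<otimes>\<^bsub>G\<^esub> inv\<^bsub>G\<^esub> w = ?x \<otimes>\<^bsub>G\<^esub> (inv\<^bsub>G\<^esub> ?w \<otimes>\<^bsub>G\<^esub> w) \<otimes>\<^bsub>G\<^esub> inv\<^bsub>G\<^esub> w"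
      by (simp add: G.m_assoc[symmetric])
    also have "\<dots> = ?x \<otimes>\<^bsub>G\<^esub> inv\<^bsub>G\<^esub> ?w"
      by (simp add: G.m_assoc)
    also have "\<dots> = conjugation G (s u) (x \<otimes>\<^bsub>G\<^esub> inv\<^bsub>G\<^esub> w)"
      using su by (simp add: G.conjugation_mult G.conjugation_inv)
    finally show ?thesis ..
  qed
  moreover have "x \<otimes>\<^bsub>G\<^esub> inv\<^bsub>G\<^esub> w \<in> centralizer G K"
    using x w subgroup_centralizer_K by (simp add: subgroup.m_closed subgroup.m_inv_closed)
  ultimately have "x \<otimes>\<^bsub>G\<^esub> inv\<^bsub>G\<^esub> w = \<one>\<^bsub>G\<^esub>"
    using FC finite_conjugacy_class_centralizing[OF idx] by simp
  then have "\<pi> (x \<otimes>\<^bsub>G\<^esub> inv\<^bsub>G\<^esub> w) = \<one>\<^bsub>Q\<^esub>"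
    by simp
  then show "p = q"
    using H.inv_solve_right[of "\<one>\<^bsub>Q\<^esub>" "\<pi> x" "\<pi> w"]
    by (simp flip: x(2) w(2))
qed

section \<open>Triviality of finite classes from (i) and injectivity\<close>

lemma trivial_of_finite_conjugacy_class:
  assumes surj: "\<pi> ` carrier G = carrier Q" and FCK: "FC_in G K = {\<one>\<^bsub>G\<^esub>}"
    and inj: "inj_on (Xi G K Q s k) (ker_FC_coupling G K Q \<pi>)"
    and g: "g \<in> carrier G" and fin: "finite (conjugacy_class G g)"
  shows "g = \<one>\<^bsub>G\<^esub>"
proof -
  note [simp] = g
  have trivial: "y = \<one>\<^bsub>G\<^esub>" if "y \<in> K" "finite (conjugacy_class G y)" for y
    using that FCK by (auto simp: FC_in_def)
  have FC: "\<pi> g \<in> FC Q"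
    using finite_conjugacy_class_hom[OF surj g fin] by (simp add: FC_def FC_in_def)
  \<comment> \<open>This commutator is a product of two elements with finite classes, so by (i) it
    vanishes as soon as it lies in \<open>K\<close>.\<close>
  have commute: "conjugation G x g = g"
    if x: "x \<in> carrier G" and in_K: "inv\<^bsub>G\<^esub> (conjugation G x g) \<otimes>\<^bsub>G\<^esub> g \<in> K" for x
  proof -
    have "finite (conjugacy_class G (inv\<^bsub>G\<^esub> (conjugation G x g) \<otimes>\<^bsub>G\<^esub> g))"
      using x fin G.finite_conjugacy_class_mult G.finite_conjugacy_class_inv
        G.finite_conjugacy_class_conjugation
      by (simp add: G.conjugation_closed)
    then have "inv\<^bsub>G\<^esub> (conjugation G x g) \<otimes>\<^bsub>G\<^esub> g = \<one>\<^bsub>G\<^esub>"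
      using trivial in_K by blast
    then show ?thesis
      using x G.inv_solve_left'[of "\<one>\<^bsub>G\<^esub>" "conjugation G x g" g] by (simp add: G.conjugation_closed)
  qed
  have "g \<otimes>\<^bsub>G\<^esub> x = x \<otimes>\<^bsub>G\<^esub> g" if x: "x \<in> K" for x
  proof -
    have xG: "x \<in> carrier G" and px: "\<pi> x = \<one>\<^bsub>Q\<^esub>"
      using x by (simp_all add: K_iff)
    have "\<pi> (inv\<^bsub>G\<^esub> (conjugation G x g) \<otimes>\<^bsub>G\<^esub> g) = \<one>\<^bsub>Q\<^esub>"
      using xG px by (simp add: conjugation_def)
    moreover have "inv\<^bsub>G\<^esub> (conjugation G x g) \<otimes>\<^bsub>G\<^esub> g \<in> carrier G"
      using xG by (simp add: G.conjugation_closed)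
    ultimately have "conjugation G x g = g"
      using xG by (intro commute) (simp_all only: K_iff simp_thms)
    then show ?thesis
      using G.conjugation_eq_self_iff[OF xG g] by simp
  qed
  then have cen: "g \<in> centralizer G K"
    by (simp add: centralizer_def)
  \<comment> \<open>Since \<open>u\<close> commutes with \<open>\<pi> g\<close> in
    \<open>FC Q\<close>, the commutator lies over 1; \<open>b_cocycle\<close> records this, even
    with values in \<open>Z\<close>.\<close>
  have "conjugation G (s u) g = g" if u: "u \<in> P" for u
  proof (rule commute)
    have "inv\<^bsub>G\<^esub> (conjugation G (s u) g) \<otimes>\<^bsub>G\<^esub> g \<in> Z"
      using b_cocycle[OF cen FC] u by (force simp: cocycle_group_def)
    then show "inv\<^bsub>G\<^esub> (conjugation G (s u) g) \<otimes>\<^bsub>G\<^esub> g \<in> K"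
      by (simp add: Z_iff)
  qed (use u P_closed s_closed in simp)
  \<comment> \<open>Both cocycles are constantly 1, so \<open>g\<close> and 1 are lifts with the
    same class.\<close>
  then have "b g = b \<one>\<^bsub>G\<^esub>"
    using P_closed s_closed by (intro restrict_ext) (simp add: conjugation_def[of G _ "\<one>\<^bsub>G\<^esub>"])
  moreover have one: "\<one>\<^bsub>G\<^esub> \<in> centralizer G K" "\<pi> \<one>\<^bsub>G\<^esub> \<in> FC Q"
    using subgroup.one_closed[OF subgroup_centralizer_K] FC_one by simp_all
  ultimately have "Xi G K Q s k (\<pi> g) = Xi G K Q s k (\<pi> \<one>\<^bsub>G\<^esub>)"
    using Xi_lift[OF cen FC] Xi_lift[OF one] by simp
  then have "\<pi> g = \<pi> \<one>\<^bsub>G\<^esub>"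
    using inj centralizer_in_ker cen FC one by (meson inj_onD)
  \<comment> \<open>Now \<open>g\<close> itself lies in \<open>K\<close>, and (i) applies to it
    directly.\<close>
  then show ?thesis
    using trivial fin by (simp add: K_iff)
qed

end

theorem proposition2p7:
  fixes G :: "('a, 'm) monoid_scheme" and Q :: "('b, 'n) monoid_scheme"
    and K :: "'a set" and \<pi> :: "'a \<Rightarrow> 'b" and s k :: "'b \<Rightarrow> 'a"
  assumes "group G" and "group Q" and "carrier G \<noteq> {\<one>\<^bsub>G\<^esub>}"
    and "\<pi> \<in> epi G Q" and "K = kernel G Q \<pi>"
    and "fin_gen_subgroup Q (FC Q) \<or> finite_index Q (centralizer Q (FC Q))"
    and "set_section G Q \<pi> s" and "kernel_choice G K Q \<pi> s k"
  shows "icc G \<longleftrightarrow>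
    FC_in G K = {\<one>\<^bsub>G\<^esub>} \<and> inj_on (Xi G K Q s k) (ker_FC_coupling G K Q \<pi>)"
proof -
  interpret G: group G by fact
  interpret Q: group Q by fact
  have hom: "group_hom G Q \<pi>" and surj: "\<pi> ` carrier G = carrier Q"
    using assms(4) by (auto simp: epi_def intro!: group_hom.intro group_hom_axioms.intro assms)
  interpret chosen_extension G Q K \<pi> s k
    using hom assms by unfold_locales auto
  \<comment> \<open>The finitely generated case reduces to the finite index case, the only one used
    from here on.\<close>
  have idx: "finite_index Q (centralizer Q (FC Q))"
    using assms(6) Q.finite_index_centralizer_FC by blast
  show ?thesis
    unfolding G.icc_iff[OF assms(3)]
  proof (intro iffI conjI)
    assume FC: "\<forall>x\<in>carrier G. finite (conjugacy_class G x) \<longrightarrow> x = \<one>\<^bsub>G\<^esub>"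
    show "inj_on (Xi G K Q s k) (ker_FC_coupling G K Q \<pi>)"
      using FC by (intro inj_on_Xi[OF idx]) blast
    have "\<one>\<^bsub>G\<^esub> \<in> FC_in G K"
      using G.finite_conjugacy_class_one hom by (simp add: FC_in_def K_iff group_hom.hom_one)
    then show "FC_in G K = {\<one>\<^bsub>G\<^esub>}"
      using FC by (auto simp: FC_in_def K_iff)
  next
    assume "FC_in G K = {\<one>\<^bsub>G\<^esub>} \<and> inj_on (Xi G K Q s k) (ker_FC_coupling G K Q \<pi>)"
    then show "\<forall>x\<in>carrier G. finite (conjugacy_class G x) \<longrightarrow> x = \<one>\<^bsub>G\<^esub>"
      using trivial_of_finite_conjugacy_class[OF surj] by blast
  qed
qed

end
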